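(* Let $V$ be the $\mathcal O_q$-module, with associated notation, described in the context. The following holds on $V$: $$H=t_d\sum_{i=0}^{d}\frac{a^{-i}q^{id}(A-\theta_dI)(A-\theta_{d-1}I)\cdots(A-\theta_{d-i+1}I)}{(q^2;q^2)_i},$$ $$H^{-1}=t_d^{-1}\sum_{i=0}^{d}\frac{a^{i}q^{-id}(A-\theta_dI)(A-\theta_{d-1}I)\cdots(A-\theta_{d-i+1}I)}{(q^{-2};q^{-2})_i}.$$
   Context: Setting. $\mathbb F$ is a field and $q\in\mathbb F$ is nonzero and not a root of unity. Algebras are associative, unital, over $\mathbb F$. Write $[X,Y]=XY-YX$, $[X,Y]_q=qXY-q^{-1}YX$, $[X,Y]_{q^{-1}}=q^{-1}XY-qYX$. The $q$-Onsager algebra $\mathcal O_q$ is defined by generators $A,A^*$ and relations $[A,[A,[A,A^*]_q]_{q^{-1}}]=(q^2-q^{-2})^2[A^*,A]$ and $[A^*,[A^*,[A^*,A]_q]_{q^{-1}}]=(q^2-q^{-2})^2[A,A^*]$. $V$ is an irreducible $\mathcal O_q$-module of finite dimension at least $2$ on which each of $A,A^*$ is diagonalizable. Eigenspaces. The eigenvalues of $A$ on $V$ can be ordered as mutually distinct $\theta_0,\dots,\theta_d$ ($d\ge 1$) such that $\theta_i=aq^{d-2i}+a^{-1}q^{2i-d}$ ($0\le i\le d$) for some nonzero $a\in\mathbb F$; fix such an ordering and $a$. $V_i$ is the $\theta_i$-eigenspace of $A$ and $E_i\in\mathrm{End}(V)$ is the projection onto $V_i$ along $\bigoplus_{j\ne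 i}V_j$. The map $H$. Let $t_{ij}=1+\frac{\theta_i-\theta_j}{q-q^{-1}}\cdot\frac{q\theta_i-q^{-1}\theta_j}{q^2-q^{-2}}$, $t_i=t_{01}t_{12}\cdots t_{i-1,i}$ ($t_0=1$), and $H=\sum_{i=0}^d t_iE_i\in\mathrm{End}(V)$; each $t_i\neq0$, so $H$ is invertible with $H^{-1}=\sum_{i=0}^d t_i^{-1}E_i$. Notation. $(z;t)_n=(1-z)(1-zt)\cdots(1-zt^{n-1})$ for $n\in\mathbb N=\{0,1,2,\dots\}$; empty products equal $1$ (or $I$). *)

theory Defs
  imports Complex_Main "HOL-Library.Poly_Mapping" "HOL-Algebra.QuotRing"
begin

section \<open>The \<open>q\<close>-Onsager algebra\<close>

text \<open>
  The free algebra on two generators is the monoid algebra of the free monoid on two letters.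
  \<^theory>\<open>HOL-Library.Poly_Mapping\<close> multiplies by convolution over a monoid written additively
  (not assumed commutative), so the words are made an instance of \<^class>\<open>monoid_add\<close>.
\<close>

datatype generator = Gen_A | Gen_Astar

datatype word = Word "generator list"

instantiation word :: monoid_add
begin

definition zero_word :: word where "zero_word = Word []"

fun plus_word :: "word \<Rightarrow> word \<Rightarrow> word" where
  "plus_word (Word u) (Word v) = Word (u @ v)"

instance
proof
  fix a b c :: word
  show "a + b + c = a + (b + c)" by (cases a; cases b; cases c) simp
  show "0 + a = a" by (cases a) (simp add: zero_word_def)
  show "a + 0 = a" by (cases a) (simp add: zero_word_def)
qed

end

type_synonym 'f free_alg = "word \<Rightarrow>\<^sub>0 'f"

definition scalar :: "'f::field \<Rightarrow> 'f free_alg" where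
  "scalar c = Poly_Mapping.single 0 c"

definition gen :: "generator \<Rightarrow> 'f::field free_alg" where
  "gen g = Poly_Mapping.single (Word [g]) 1"

definition commutator :: "'f::field free_alg \<Rightarrow> 'f free_alg \<Rightarrow> 'f free_alg" where
  "commutator X Y = X * Y - Y * X"

definition q_commutator :: "'f::field \<Rightarrow> 'f free_alg \<Rightarrow> 'f free_alg \<Rightarrow> 'f free_alg" where
  "q_commutator q X Y = scalar q * X * Y - scalar (inverse q) * Y * X"

text \<open>The difference of the two sides of the defining relation
  \<open>[X,[X,[X,Y]\<^sub>q]\<^sub>q\<^sub>-\<^sub>1] = (q\<^sup>2 - q\<^sup>-\<^sup>2)\<^sup>2 [Y,X]\<close>;
  \<open>q_commutator (inverse q)\<close> is the bracket with \<open>q\<close> and its inverse interchanged.\<close>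

definition onsager_relator :: "'f::field \<Rightarrow> 'f free_alg \<Rightarrow> 'f free_alg \<Rightarrow> 'f free_alg" where
  "onsager_relator q X Y =
     commutator X (q_commutator (inverse q) X (q_commutator q X Y))
     - scalar ((q\<^sup>2 - (inverse q)\<^sup>2)\<^sup>2) * commutator Y X"

definition free_ring :: "('f::field free_alg) ring" where
  "free_ring = \<lparr>carrier = UNIV, mult = (*), one = 1, zero = 0, add = (+)\<rparr>"

text \<open>\<^const>\<open>genideal\<close> is the generated two-sided ideal.\<close>

definition onsager_ideal :: "'f::field \<Rightarrow> 'f free_alg set" where
  "onsager_ideal q =
     genideal free_ring {onsager_relator q (gen Gen_A) (gen Gen_Astar),
                         onsager_relator q (gen Gen_Astar) (gen Gen_A)}"

definition q_onsager :: "'f::field \<Rightarrow> ('f free_alg set) ring" where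
  "q_onsager q = free_ring Quot (onsager_ideal q)"

definition onsager_class :: "'f::field \<Rightarrow> 'f free_alg \<Rightarrow> 'f free_alg set" where
  "onsager_class q x = onsager_ideal q +>\<^bsub>free_ring\<^esub> x"


section \<open>Modules\<close>

definition end_ring :: "('f::field \<Rightarrow> 'v::ab_group_add \<Rightarrow> 'v) \<Rightarrow> ('v \<Rightarrow> 'v) ring" where
  "end_ring scale = \<lparr>carrier = {f. Vector_Spaces.linear scale scale f},
     mult = (\<circ>), one = id, zero = (\<lambda>v. 0), add = (\<lambda>f g v. f v + g v)\<rparr>"

text \<open>A module structure on the vector space given by \<open>scale\<close> is a homomorphism of unital
  algebras \<open>\<rho>\<close> into its endomorphisms: a unital ring homomorphism that respects the scalars.\<close>

definition onsager_module ::
  "'f::field \<Rightarrow> ('f \<Rightarrow> 'v::ab_group_add \<Rightarrow> 'v) \<Rightarrow> ('f free_alg set \<Rightarrow> 'v \<Rightarrow> 'v) \<Rightarrow> bool" where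
  "onsager_module q scale \<rho> \<longleftrightarrow>
     vector_space scale \<and>
     \<rho> \<in> ring_hom (q_onsager q) (end_ring scale) \<and>
     (\<forall>c. \<rho> (onsager_class q (scalar c)) = scale c)"

definition onsager_irreducible ::
  "'f::field \<Rightarrow> ('f \<Rightarrow> 'v::ab_group_add \<Rightarrow> 'v) \<Rightarrow> ('f free_alg set \<Rightarrow> 'v \<Rightarrow> 'v) \<Rightarrow> bool" where
  "onsager_irreducible q scale \<rho> \<longleftrightarrow>
     (UNIV :: 'v set) \<noteq> {0} \<and>
     (\<forall>W. module.subspace scale W \<and> (\<forall>x\<in>carrier (q_onsager q). \<rho> x ` W \<subseteq> W)
        \<longrightarrow> W = {0} \<or> W = UNIV)"


section \<open>Linear algebra\<close>

definition eigenspace :: "('f \<Rightarrow> 'v::ab_group_add \<Rightarrow> 'v) \<Rightarrow> ('v \<Rightarrow> 'v) \<Rightarrow> 'f \<Rightarrow> 'v set" where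
  "eigenspace scale T c = {v. T v = scale c v}"

definition eigenvalues :: "('f \<Rightarrow> 'v::ab_group_add \<Rightarrow> 'v) \<Rightarrow> ('v \<Rightarrow> 'v) \<Rightarrow> 'f set" where
  "eigenvalues scale T = {c. \<exists>v. v \<noteq> 0 \<and> T v = scale c v}"

definition diagonalizable :: "('f::field \<Rightarrow> 'v::ab_group_add \<Rightarrow> 'v) \<Rightarrow> ('v \<Rightarrow> 'v) \<Rightarrow> bool" where
  "diagonalizable scale T \<longleftrightarrow> module.span scale (\<Union>c. eigenspace scale T c) = UNIV"

text \<open>The projection onto \<open>W\<close> along \<open>U\<close>; meaningful when the space is the direct sum
  of the subspaces \<open>W\<close> and \<open>U\<close>.\<close>

definition projection_along :: "'v::ab_group_add set \<Rightarrow> 'v set \<Rightarrow> 'v \<Rightarrow> 'v" where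
  "projection_along W U v = (THE w. w \<in> W \<and> v - w \<in> U)"

definition eigenprojection ::
  "('f::field \<Rightarrow> 'v::ab_group_add \<Rightarrow> 'v) \<Rightarrow> ('v \<Rightarrow> 'v) \<Rightarrow> nat \<Rightarrow> (nat \<Rightarrow> 'f) \<Rightarrow> nat \<Rightarrow> 'v \<Rightarrow> 'v" where
  "eigenprojection scale T d \<theta> i =
     projection_along (eigenspace scale T (\<theta> i))
       (module.span scale (\<Union>j\<in>{0..d} - {i}. eigenspace scale T (\<theta> j)))"


section \<open>The map \<open>H\<close>\<close>

definition t_pair :: "'f::field \<Rightarrow> (nat \<Rightarrow> 'f) \<Rightarrow> nat \<Rightarrow> nat \<Rightarrow> 'f" where
  "t_pair q \<theta> i j =
     1 + (\<theta> i - \<theta> j) / (q - inverse q)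
       * ((q * \<theta> i - inverse q * \<theta> j) / (q\<^sup>2 - (inverse q)\<^sup>2))"

definition t_coeff :: "'f::field \<Rightarrow> (nat \<Rightarrow> 'f) \<Rightarrow> nat \<Rightarrow> 'f" where
  "t_coeff q \<theta> i = (\<Prod>k=1..i. t_pair q \<theta> (k - 1) k)"

definition H_map ::
  "'f::field \<Rightarrow> ('f \<Rightarrow> 'v::ab_group_add \<Rightarrow> 'v) \<Rightarrow> ('v \<Rightarrow> 'v) \<Rightarrow> nat \<Rightarrow> (nat \<Rightarrow> 'f) \<Rightarrow> 'v \<Rightarrow> 'v" where
  "H_map q scale T d \<theta> v =
     (\<Sum>i=0..d. scale (t_coeff q \<theta> i) (eigenprojection scale T d \<theta> i v))"

definition q_shifted_factorial :: "'f::field \<Rightarrow> 'f \<Rightarrow> nat \<Rightarrow> 'f" where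
  "q_shifted_factorial z t n = (\<Prod>k<n. 1 - z * t ^ k)"

text \<open>\<open>(T - \<theta>\<^sub>d I)(T - \<theta>\<^sub>d\<^sub>-\<^sub>1 I) \<cdots>\<close> with \<open>i\<close> factors; used only for \<open>i \<le> d\<close>,
  so the subtraction does not truncate.\<close>

primrec top_product ::
  "('f::field \<Rightarrow> 'v::ab_group_add \<Rightarrow> 'v) \<Rightarrow> ('v \<Rightarrow> 'v) \<Rightarrow> nat \<Rightarrow> (nat \<Rightarrow> 'f) \<Rightarrow> nat \<Rightarrow> 'v \<Rightarrow> 'v" where
  "top_product scale T d \<theta> 0 = id"
| "top_product scale T d \<theta> (Suc i) =
     top_product scale T d \<theta> i \<circ> (\<lambda>v. T v - scale (\<theta> (d - i)) v)"

end

theory Submission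
  imports Defs
begin

text \<open>
  Since \<open>A\<close> is diagonalizable with eigenvalues \<open>\<theta>\<^sub>0, \<dots>, \<theta>\<^sub>d\<close>, every vector is a sum of
  vectors \<open>v\<^sub>j\<close> of the eigenspaces. On \<open>v\<^sub>j\<close> the map \<open>H\<close> acts as the scalar \<open>t\<^sub>j\<close>, and a linear
  combination of the products \<open>(A - \<theta>\<^sub>d I) \<cdots> (A - \<theta>\<^bsub>d-i+1\<^esub> I)\<close> acts as its value at \<open>\<theta>\<^sub>j\<close>. So
  both formulas are identities between scalars: a polynomial in Newton form with nodes
  \<open>\<theta>\<^sub>d, \<theta>\<^bsub>d-1\<^esub>, \<dots>\<close> has to take the value \<open>t\<^sub>j\<close>, respectively its inverse, at \<open>\<theta>\<^sub>j\<close>.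

  With \<open>\<theta>\<^sub>i = a q\<^bsup>d-2i\<^esup> + a\<^sup>-\<^sup>1 q\<^bsup>2i-d\<^esup>\<close> each factor of \<open>t\<^sub>i\<close> is a perfect square, and the product
  is \<open>t\<^sub>i = a\<^bsup>2i\<^esup> q\<^bsup>2i(d-i)\<^esup>\<close> (\<open>t_coeff_closed_form\<close>); in particular it is nonzero,
  so \<open>H\<close> is invertible.
  Put \<open>p = q\<^sup>2\<close>, \<open>n = d - j\<close> and \<open>c = a\<^sup>-\<^sup>2 p\<^sup>j\<close>. The key factorization is
  \<open>a\<^sup>-\<^sup>1 q\<^sup>d (\<theta>\<^sub>j - \<theta>\<^bsub>d-k\<^esub>) = (1 - p\<^bsup>n-k\<^esup>) (c - p\<^sup>k)\<close>,
  which turns the Newton form at \<open>\<theta>\<^sub>j\<close> into the sum of \<open>(c - 1)(c - p) \<cdots> (c - p\<^bsup>i-1\<^esup>)\<close> weighted by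
  Gaussian binomial coefficients of \<open>n\<close> and \<open>i\<close> in base \<open>p\<close>. By Cauchy's identity
  (\<open>cauchy_gauss_binomial\<close>) this sum is \<open>c\<^sup>n = t\<^sub>j / t\<^sub>d\<close>.

  The second formula is the first one for \<open>a\<^sup>-\<^sup>1\<close> and \<open>q\<^sup>-\<^sup>1\<close>: this change leaves every \<open>\<theta>\<^sub>i\<close> fixed and,
  by the closed form, inverts every \<open>t\<^sub>i\<close>.
\<close>

section \<open>Gaussian binomials and Cauchy's identity\<close>

text \<open>
  The numerator is written with integer exponents so that the recursions in \<open>i\<close> also hold
  beyond \<open>i = n\<close>, where the factor with \<open>k = n\<close> makes the coefficient vanish.
\<close>

definition gauss_binomial :: "'f::field \<Rightarrow> nat \<Rightarrow> nat \<Rightarrow> 'f" where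
  "gauss_binomial p n i = (\<Prod>k<i. 1 - p powi (int n - int k)) / q_shifted_factorial p p i"

lemma q_shifted_factorial_Suc:
  "q_shifted_factorial p p (Suc i) = q_shifted_factorial p p i * (1 - p ^ Suc i)"
  by (simp add: q_shifted_factorial_def)

lemma q_shifted_factorial_nonzero:
  fixes p :: "'f::field"
  assumes "\<And>n::nat. n \<ge> 1 \<Longrightarrow> p ^ n \<noteq> 1"
  shows "q_shifted_factorial p p i \<noteq> 0"
proof (induction i)
  case (Suc i)
  then show ?case using assms[of "Suc i"] by (simp add: q_shifted_factorial_Suc)
qed (simp add: q_shifted_factorial_def)

lemma gauss_binomial_0 [simp]: "gauss_binomial p n 0 = 1"
  by (simp add: gauss_binomial_def q_shifted_factorial_def)

lemma gauss_binomial_eq_0: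
  assumes "n < i"
  shows "gauss_binomial p n i = 0"
proof -
  have "(\<Prod>k<i. 1 - p powi (int n - int k)) = 0"
    using assms by (intro prod_zero bexI[of _ n]) auto
  then show ?thesis by (simp add: gauss_binomial_def)
qed

text \<open>
  Over the common denominator this is
  \<open>(1 - p\<^bsup>i+1\<^esup>) + p\<^bsup>i+1\<^esup> (1 - p\<^bsup>n-i\<^esup>) = 1 - p\<^bsup>n+1\<^esup>\<close>.
\<close>

lemma gauss_binomial_pascal:
  fixes p :: "'f::field"
  assumes p: "p \<noteq> 0" and p_pow: "\<And>n::nat. n \<ge> 1 \<Longrightarrow> p ^ n \<noteq> 1"
  shows "gauss_binomial p (Suc n) (Suc i) =
    gauss_binomial p n i + p ^ Suc i * gauss_binomial p n (Suc i)"
proof -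
  let ?N = "\<lambda>n i. \<Prod>k<i. 1 - p powi (int n - int k)"
  let ?D = "q_shifted_factorial p p"
  have top: "?N (Suc n) (Suc i) = (1 - p ^ Suc n) * ?N n i"
    unfolding prod.lessThan_Suc_shift
    by (simp add: power_int_add[OF disjI1[OF p]] algebra_simps)
  have shift: "p ^ Suc i * p powi (int n - int i) = p ^ Suc n"
    using p by (simp add: power_int_diff)
  have "?D i \<noteq> 0" and D: "1 - p ^ Suc i \<noteq> 0"
    using q_shifted_factorial_nonzero[of p i] p_pow p_pow[of "Suc i"] by auto
  then have "gauss_binomial p n i + p ^ Suc i * gauss_binomial p n (Suc i) =
      ?N n i * ((1 - p ^ Suc i) + p ^ Suc i * (1 - p powi (int n - int i))) / ?D (Suc i)"
    unfolding gauss_binomial_def q_shifted_factorial_Suc prod.lessThan_Suc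
    by (simp add: divide_simps del: power_Suc) (simp add: algebra_simps del: power_Suc)
  also have "(1 - p ^ Suc i) + p ^ Suc i * (1 - p powi (int n - int i)) = 1 - p ^ Suc n"
    using shift by (simp add: right_diff_distrib del: power_Suc)
  finally show ?thesis
    unfolding gauss_binomial_def top by (simp only: mult.commute)
qed

text \<open>
  The expansion of \<open>c\<^sup>n\<close> in the Newton basis \<open>F\<^sub>i = (c - 1)(c - p) \<cdots> (c - p\<^bsup>i-1\<^esup>)\<close>. Since
  \<open>c F\<^sub>i = F\<^bsub>i+1\<^esub> + p\<^sup>i F\<^sub>i\<close>, multiplying by \<open>c\<close> acts on the coefficients as the Pascal recursion.
\<close>

lemma cauchy_gauss_binomial:
  fixes p c :: "'f::field"
  assumes p: "p \<noteq> 0" and p_pow: "\<And>n::nat. n \<ge> 1 \<Longrightarrow> p ^ n \<noteq> 1"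
  shows "(\<Sum>i\<le>n. gauss_binomial p n i * (\<Prod>k<i. c - p ^ k)) = c ^ n"
proof (induction n)
  case (Suc n)
  let ?F = "\<lambda>i. \<Prod>k<i. c - p ^ k"
  let ?b = "gauss_binomial p"
  have "c ^ Suc n = (\<Sum>i\<le>n. ?b n i * (c * ?F i))"
    using Suc.IH by (simp add: sum_distrib_left mult_ac flip: Suc.IH)
  also have "\<dots> = (\<Sum>i\<le>n. ?b n i * ?F (Suc i)) + (\<Sum>i\<le>n. p ^ i * ?b n i * ?F i)"
    by (simp add: sum.distrib[symmetric] algebra_simps)
  also have "(\<Sum>i\<le>n. p ^ i * ?b n i * ?F i) = (\<Sum>i\<le>Suc n. p ^ i * ?b n i * ?F i)"
    by (simp add: gauss_binomial_eq_0)
  also have "\<dots> = 1 + (\<Sum>i\<le>n. p ^ Suc i * ?b n (Suc i) * ?F (Suc i))"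
    by (subst sum.atMost_Suc_shift) simp
  also have "(\<Sum>i\<le>n. ?b n i * ?F (Suc i)) + \<dots> =
      1 + (\<Sum>i\<le>n. ?b (Suc n) (Suc i) * ?F (Suc i))"
    by (simp only: gauss_binomial_pascal[OF p p_pow] distrib_right sum.distrib ac_simps)
      (simp only: distrib_left sum.distrib ac_simps)
  also have "\<dots> = (\<Sum>i\<le>Suc n. ?b (Suc n) i * ?F i)"
    by (subst sum.atMost_Suc_shift) simp
  finally show ?case by simp
qed simp

section \<open>The scalars by which the two sides act on an eigenspace\<close>

text \<open>
  With \<open>x = a q\<^bsup>d-2i\<^esup>\<close> the two differences in \<open>t_pair\<close> factor so that the denominators cancel and
  \<open>1 + (x/q - q/x)(x/q) = (x/q)\<^sup>2\<close> remains.
\<close>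

lemma t_coeff_closed_form:
  fixes q a :: "'f::field" and \<theta> :: "nat \<Rightarrow> 'f"
  assumes q: "q \<noteq> 0" and q_pow: "\<And>n::nat. n \<ge> 1 \<Longrightarrow> q ^ n \<noteq> 1" and a: "a \<noteq> 0"
    and theta: "\<And>i. i \<le> d \<Longrightarrow>
      \<theta> i = a * q powi (int d - 2 * int i) + inverse a * q powi (2 * int i - int d)"
  shows "i \<le> d \<Longrightarrow> t_coeff q \<theta> i = a ^ (2 * i) * q ^ (2 * i * (d - i))"
proof (induction i)
  case 0
  then show ?case by (simp add: t_coeff_def)
next
  case (Suc i)
  define x where "x = a * q powi (int d - 2 * int i)"
  have x: "x \<noteq> 0" using a q by (simp add: x_def)
  have th_i: "\<theta> i = x + inverse x"
    using theta[of i] Suc.prems a q by (simp add: x_def power_int_diff field_simps)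
  have th_Suc: "\<theta> (Suc i) = x / q\<^sup>2 + q\<^sup>2 / x"
    using theta[of "Suc i"] Suc.prems a q
    by (simp add: x_def power_int_diff power_int_add field_simps)
  have "q\<^sup>2 - 1 \<noteq> 0" using q_pow[of 2] by simp
  then have q2: "q - inverse q \<noteq> 0" using q by (simp add: field_simps power2_eq_square)
  have "q ^ 4 - 1 \<noteq> 0" using q_pow[of 4] by simp
  then have q4: "q\<^sup>2 - (inverse q)\<^sup>2 \<noteq> 0"
    using q by (simp add: field_simps power2_eq_square power4_eq_xxxx)
  have diff: "\<theta> i - \<theta> (Suc i) = (q - inverse q) * (x / q - q / x)"
    unfolding th_i th_Suc using q x by (simp add: field_simps power2_eq_square)
  have skew: "q * \<theta> i - inverse q * \<theta> (Suc i) = (q\<^sup>2 - (inverse q)\<^sup>2) * (x / q)"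
    unfolding th_i th_Suc using q x by (simp add: field_simps power2_eq_square)
  have "t_pair q \<theta> i (Suc i) = 1 + (x / q - q / x) * (x / q)"
    unfolding t_pair_def diff skew using q2 q4 by simp
  also have "\<dots> = (x / q)\<^sup>2"
    using q x by (simp add: field_simps power2_eq_square)
  finally have pair: "t_pair q \<theta> i (Suc i) = (x / q)\<^sup>2" .
  define m where "m = d - Suc i"
  have d: "d = Suc (i + m)" using Suc.prems by (simp add: m_def)
  have "x = a * q * q ^ m / q ^ i"
    using q by (simp add: x_def d power_int_diff power_int_add power_int_mult power_mult power2_eq_square
      power_mult_distrib power_add field_simps)
  then have xq: "(x / q)\<^sup>2 = a\<^sup>2 * q ^ (2 * m) / q ^ (2 * i)"
    using q by (simp add: power_mult power_divide power_mult_distrib mult.commute power_even_eq)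
  have "t_coeff q \<theta> (Suc i) = t_coeff q \<theta> i * (x / q)\<^sup>2"
    by (simp add: t_coeff_def pair)
  also have "t_coeff q \<theta> i = a ^ (2 * i) * q ^ (2 * i * Suc m)"
    using Suc by (simp add: d)
  also have "a ^ (2 * i) * q ^ (2 * i * Suc m) * (x / q)\<^sup>2 =
      a ^ (2 * Suc i) * q ^ (2 * Suc i * m)"
    unfolding xq using q by (simp add: power_add field_simps power2_eq_square)
  finally show ?case by (simp add: m_def)
qed

text \<open>
  The right-hand side is \<open>t\<^sub>j\<close> and the leading factor \<open>t\<^sub>d\<close>. Stating both by their closed forms
  makes the lemma usable again with \<open>a\<close> and \<open>q\<close> replaced by their inverses.
\<close>

lemma newton_expansion_at_theta:
  fixes q a :: "'f::field" and \<theta> :: "nat \<Rightarrow> 'f"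
  assumes q: "q \<noteq> 0" and q_pow: "\<And>n::nat. n \<ge> 1 \<Longrightarrow> q ^ n \<noteq> 1" and a: "a \<noteq> 0"
    and theta: "\<And>i. i \<le> d \<Longrightarrow>
      \<theta> i = a * q powi (int d - 2 * int i) + inverse a * q powi (2 * int i - int d)"
    and j: "j \<le> d"
  shows "a ^ (2 * d) * (\<Sum>i=0..d. a powi (- int i) * q powi (int i * int d)
            / q_shifted_factorial (q\<^sup>2) (q\<^sup>2) i * (\<Prod>k<i. \<theta> j - \<theta> (d - k)))
         = a ^ (2 * j) * q ^ (2 * j * (d - j))"
proof -
  define p where "p = q\<^sup>2"
  define c where "c = p ^ j / a\<^sup>2"
  define n where "n = d - j"
  have d: "d = n + j" using j by (simp add: n_def)
  have p: "p \<noteq> 0" using q by (simp add: p_def)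
  have p_pow: "p ^ m \<noteq> 1" if "m \<ge> 1" for m :: nat
    using q_pow[of "2 * m"] that by (simp add: p_def power_mult)
  \<comment> \<open>The zero at \<open>k = n\<close> comes from \<open>\<theta>\<^sub>j = \<theta>\<^bsub>d-n\<^esub>\<close>; the other factor comes from the symmetry
     \<open>x \<mapsto> x\<^sup>-\<^sup>1\<close> of \<open>x + x\<^sup>-\<^sup>1\<close>.\<close>
  have factor: "q ^ d / a * (\<theta> j - \<theta> (d - k)) =
      (1 - p powi (int n - int k)) * (c - p ^ k)" if "k \<le> d" for k
  proof -
    define N J K where "N = q ^ n" and "J = q ^ j" and "K = q ^ k"
    have nz: "N \<noteq> 0" "J \<noteq> 0" "K \<noteq> 0" using q by (auto simp: N_def J_def K_def)
    have pw: "p ^ j = J\<^sup>2" "p ^ k = K\<^sup>2" "p ^ n = N\<^sup>2"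
      by (simp_all add: p_def N_def J_def K_def power_mult[symmetric] mult.commute)
    have qp: "q powi (2 * int m) = p ^ m" for m
      by (simp add: p_def power_int_mult)
    have "\<theta> j = a * (N / J) + inverse a * (J / N)"
      using theta[OF j] q nz
      by (simp add: d power_int_diff power_int_add qp pw field_simps flip: N_def J_def)
    moreover have "\<theta> (d - k) = a * (K\<^sup>2 / (N * J)) + inverse a * (N * J / K\<^sup>2)"
    proof -
      have e: "int d - 2 * int (d - k) = 2 * int k - int d"
        "2 * int (d - k) - int d = int d - 2 * int k" using that by auto
      show ?thesis unfolding theta[OF diff_le_self] e using q
        by (simp add: d power_int_diff power_int_add qp pw flip: N_def J_def)
    qed
    moreover have "p powi (int n - int k) = N\<^sup>2 / K\<^sup>2"
      using p by (simp add: power_int_diff pw)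
    moreover have "q ^ d = N * J" by (simp add: d power_add N_def J_def)
    ultimately show ?thesis
      using nz a unfolding c_def pw
      by (simp only:) (simp add: field_simps power2_eq_square)
  qed
  have "a powi (- int i) * q powi (int i * int d) / q_shifted_factorial p p i
        * (\<Prod>k<i. \<theta> j - \<theta> (d - k))
      = gauss_binomial p n i * (\<Prod>k<i. c - p ^ k)" if "i \<le> d" for i
  proof -
    have "q powi (int i * int d) = q ^ (d * i)"
      by (metis mult.commute of_nat_mult power_int_of_nat)
    then have "a powi (- int i) * q powi (int i * int d) = (q ^ d / a) ^ i"
      by (simp add: power_int_minus power_divide power_mult power_mult_distrib divide_inverse
          power_inverse mult.commute)
    then have "a powi (- int i) * q powi (int i * int d) * (\<Prod>k<i. \<theta> j - \<theta> (d - k))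
        = (\<Prod>k<i. q ^ d / a * (\<theta> j - \<theta> (d - k)))"
      by (simp only: prod.distrib prod_constant card_lessThan)
    also have "\<dots> = (\<Prod>k<i. (1 - p powi (int n - int k)) * (c - p ^ k))"
      using that by (intro prod.cong refl factor) auto
    finally show ?thesis by (simp add: gauss_binomial_def prod.distrib)
  qed
  then have "(\<Sum>i=0..d. a powi (- int i) * q powi (int i * int d)
        / q_shifted_factorial p p i * (\<Prod>k<i. \<theta> j - \<theta> (d - k)))
      = (\<Sum>i=0..d. gauss_binomial p n i * (\<Prod>k<i. c - p ^ k))"
    by (intro sum.cong) auto
  also have "\<dots> = (\<Sum>i\<le>n. gauss_binomial p n i * (\<Prod>k<i. c - p ^ k))"
    by (intro sum.mono_neutral_right) (auto simp: d gauss_binomial_eq_0)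
  also have "\<dots> = c ^ n" by (rule cauchy_gauss_binomial[OF p p_pow])
  finally have sum_eq: "(\<Sum>i=0..d. a powi (- int i) * q powi (int i * int d)
        / q_shifted_factorial p p i * (\<Prod>k<i. \<theta> j - \<theta> (d - k))) = c ^ n" .
  have "a ^ (2 * d) = a ^ (2 * j) * (a\<^sup>2) ^ n"
    by (simp add: d power_add power_mult distrib_left)
  moreover have "c ^ n = q ^ (2 * j * n) / (a\<^sup>2) ^ n"
    by (simp add: c_def p_def power_divide power_mult)
  ultimately have "a ^ (2 * d) * c ^ n = a ^ (2 * j) * q ^ (2 * j * n)"
    using a by simp
  then show ?thesis
    by (simp only: sum_eq flip: p_def n_def)
qed

section \<open>Eigenspace decomposition\<close>

context vector_space
begin

text \<open>
  Applying \<open>T - \<theta>\<^sub>k\<close> to a vanishing sum of eigenvectors removes the \<open>k\<close>-th summand and scales the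
  others by nonzero factors, which gives independence by induction on the number of summands.
\<close>

lemma eigenspace_sum_zero:
  assumes T: "Vector_Spaces.linear scale scale T" and J: "finite J"
    and inj: "inj_on \<theta> J"
    and v: "\<And>j. j \<in> J \<Longrightarrow> T (v j) = scale (\<theta> j) (v j)"
    and sum0: "(\<Sum>j\<in>J. v j) = 0"
  shows "\<forall>j\<in>J. v j = 0"
  using J inj v sum0
proof (induction J arbitrary: v rule: finite_induct)
  case (insert k J)
  interpret T: Vector_Spaces.linear scale scale T by (fact T)
  let ?w = "\<lambda>j. scale (\<theta> j - \<theta> k) (v j)"
  have "(\<Sum>j\<in>J. ?w j) = (\<Sum>j\<in>insert k J. ?w j)"
    using insert.hyps by simp
  also have "\<dots> = T (\<Sum>j\<in>insert k J. v j) - scale (\<theta> k) (\<Sum>j\<in>insert k J. v j)"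
    unfolding T.sum scale_sum_right sum_subtractf[symmetric]
    using insert.prems(2) by (intro sum.cong) (auto simp: scale_left_diff_distrib)
  finally have "(\<Sum>j\<in>J. ?w j) = 0"
    using insert.prems(3) by (simp add: T.zero)
  moreover have "T (?w j) = scale (\<theta> j) (?w j)" if "j \<in> J" for j
    using insert.prems(2)[of j] that by (simp add: T.scale scale_left_commute)
  ultimately have w_zero: "\<forall>j\<in>J. ?w j = 0"
    using insert.prems(1) by (intro insert.IH) (auto simp: inj_on_def)
  have "\<forall>j\<in>J. v j = 0"
  proof (intro ballI)
    fix j assume j: "j \<in> J"
    then have "\<theta> j \<noteq> \<theta> k" using insert.prems(1) insert.hyps(2) by (auto simp: inj_on_def)
    then show "v j = 0" using bspec[OF w_zero j] by simp
  qed
  then show ?case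
    using insert.prems(3) insert.hyps by simp
qed simp

lemma eigenspace_subspace:
  assumes "Vector_Spaces.linear scale scale T"
  shows "subspace (eigenspace scale T c)"
proof -
  interpret T: Vector_Spaces.linear scale scale T by (fact assms)
  show ?thesis
    by (auto simp: subspace_def eigenspace_def T.zero T.add T.scale scale_right_distrib
        scale_left_commute)
qed

lemma span_UN_subspaces:
  assumes J: "finite J" and W: "\<And>j. j \<in> J \<Longrightarrow> subspace (W j)"
    and x: "x \<in> span (\<Union>j\<in>J. W j)"
  shows "\<exists>v. (\<forall>j\<in>J. v j \<in> W j) \<and> x = (\<Sum>j\<in>J. v j)"
  using x
proof (induction rule: span_induct_alt)
  case base
  show ?case using W by (intro exI[of _ "\<lambda>_. 0"]) (auto simp: subspace_0)
next
  case (step c y z)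
  then obtain k v where k: "k \<in> J" "y \<in> W k"
    and v: "\<forall>j\<in>J. v j \<in> W j" "z = (\<Sum>j\<in>J. v j)" by blast
  let ?v = "\<lambda>j. (if j = k then scale c y else 0) + v j"
  have "\<forall>j\<in>J. ?v j \<in> W j"
    using W k v by (auto intro: subspace_add subspace_scale)
  moreover have "scale c y + z = (\<Sum>j\<in>J. ?v j)"
    using J k v by (simp add: sum.distrib)
  ultimately show ?case by (intro exI[of _ ?v]) simp
qed

text \<open>
  \<open>eigenprojection\<close> is a definite description, so its value is known only once existence and
  uniqueness of the component are shown; uniqueness is the independence of the eigenspaces.
\<close>

lemma eigenprojection_sum:
  assumes T: "Vector_Spaces.linear scale scale T" and inj: "inj_on \<theta> {0..d}"
    and v: "\<And>j. j \<le> d \<Longrightarrow> v j \<in> eigenspace scale T (\<theta> j)" and i: "i \<le> d"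
  shows "eigenprojection scale T d \<theta> i (\<Sum>j=0..d. v j) = v i"
  unfolding eigenprojection_def projection_along_def
proof (rule the_equality)
  let ?V = "\<lambda>j. eigenspace scale T (\<theta> j)" and ?J = "{0..d} - {i}"
  have split: "(\<Sum>j=0..d. w j) = w i + (\<Sum>j\<in>?J. w j)" for w :: "nat \<Rightarrow> 'b"
    using i by (subst sum.remove[of _ i]) auto
  have "v j \<in> span (\<Union>j\<in>?J. ?V j)" if "j \<in> ?J" for j
    by (rule span_base) (use v[of j] that in auto)
  then have "(\<Sum>j\<in>?J. v j) \<in> span (\<Union>j\<in>?J. ?V j)" by (rule span_sum)
  then show "v i \<in> ?V i \<and> (\<Sum>j=0..d. v j) - v i \<in> span (\<Union>j\<in>?J. ?V j)"
    using v[OF i] unfolding split by simp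
  fix w
  assume w: "w \<in> ?V i \<and> (\<Sum>j=0..d. v j) - w \<in> span (\<Union>j\<in>?J. ?V j)"
  then obtain u where u: "\<And>j. j \<in> ?J \<Longrightarrow> u j \<in> ?V j"
    and rest: "(\<Sum>j=0..d. v j) - w = (\<Sum>j\<in>?J. u j)"
    using span_UN_subspaces[of ?J ?V] eigenspace_subspace[OF T] by (metis finite_Diff finite_atLeastAtMost)
  let ?u = "u(i := w)"
  let ?x = "\<lambda>j. v j - ?u j"
  have "(\<Sum>j=0..d. ?u j) = w + (\<Sum>j\<in>?J. u j)"
    unfolding split by (intro arg_cong2[of _ _ _ _ "(+)"] sum.cong) auto
  then have sum0: "(\<Sum>j=0..d. ?x j) = 0"
    using rest by (simp add: sum_subtractf algebra_simps)
  have "?x j \<in> ?V j" if "j \<in> {0..d}" for j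
    using v[of j] u[of j] w that by (intro subspace_diff[OF eigenspace_subspace[OF T]]) auto
  then have "\<forall>j\<in>{0..d}. ?x j = 0"
    by (intro eigenspace_sum_zero[OF T _ inj _ sum0]) (auto simp: eigenspace_def)
  then show "w = v i" using i by (auto dest: bspec[of _ _ i])
qed

lemma diagonalizable_eigenvector_decomposition:
  fixes \<theta> :: "nat \<Rightarrow> 'a"
  assumes T: "Vector_Spaces.linear scale scale T" and diag: "diagonalizable scale T"
    and ev: "eigenvalues scale T = \<theta> ` {0..d}"
  shows "\<exists>v. (\<forall>j\<in>{0..d}. v j \<in> eigenspace scale T (\<theta> j)) \<and> x = (\<Sum>j=0..d. v j)"
proof -
  let ?U = "\<Union>j\<in>{0..d}. eigenspace scale T (\<theta> j)"
  have "(\<Union>c. eigenspace scale T c) \<subseteq> insert 0 ?U"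
    using ev by (force simp: eigenspace_def eigenvalues_def)
  then have "span (\<Union>c. eigenspace scale T c) \<subseteq> span (insert 0 ?U)" by (rule span_mono)
  then have "x \<in> span ?U"
    using diag by (auto simp: diagonalizable_def)
  then show ?thesis
    by (intro span_UN_subspaces[of _ "\<lambda>j. eigenspace scale T (\<theta> j)"] finite_atLeastAtMost
        eigenspace_subspace[OF T])
qed

lemma linear_top_product:
  assumes "Vector_Spaces.linear scale scale T"
  shows "Vector_Spaces.linear scale scale (top_product scale T d \<theta> i)"
proof (induction i)
  case 0
  show ?case using linear_id by (simp add: id_def)
next
  case (Suc i)
  have "Vector_Spaces.linear scale scale (\<lambda>v. T v - scale (\<theta> (d - i)) v)"
    using vector_space_pair.linear_compose_sub[OF _ assms linear_scale_self] vector_space_axioms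
    by (simp add: vector_space_pair_def)
  then show ?case using Vector_Spaces.linear_compose[OF _ Suc.IH] by (simp add: comp_def)
qed

lemma top_product_eigenvector:
  assumes T: "Vector_Spaces.linear scale scale T" and v: "v \<in> eigenspace scale T c"
  shows "top_product scale T d \<theta> i v = scale (\<Prod>k<i. c - \<theta> (d - k)) v"
proof (induction i)
  case (Suc i)
  interpret P: Vector_Spaces.linear scale scale "top_product scale T d \<theta> i"
    by (rule linear_top_product[OF T])
  have "T v - scale (\<theta> (d - i)) v = scale (c - \<theta> (d - i)) v"
    using v by (simp add: eigenspace_def scale_left_diff_distrib)
  then show ?case using Suc by (simp add: P.scale mult.commute)
qed simp

text \<open>
  This reduces an operator identity to scalars: a polynomial in \<open>T\<close> in Newton form acts on each
  eigenspace by its value \<open>s j\<close> at the eigenvalue.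
\<close>

lemma newton_polynomial_eigenvector_sum:
  assumes T: "Vector_Spaces.linear scale scale T"
    and v: "\<And>j. j \<le> d \<Longrightarrow> v j \<in> eigenspace scale T (\<theta> j)"
    and s: "\<And>j. j \<le> d \<Longrightarrow> c * (\<Sum>i=0..d. b i * (\<Prod>k<i. \<theta> j - \<theta> (d - k))) = s j"
  shows "scale c (\<Sum>i=0..d. scale (b i) (top_product scale T d \<theta> i (\<Sum>j=0..d. v j)))
       = (\<Sum>j=0..d. scale (s j) (v j))"
proof -
  have "top_product scale T d \<theta> i (\<Sum>j=0..d. v j)
      = (\<Sum>j=0..d. scale (\<Prod>k<i. \<theta> j - \<theta> (d - k)) (v j))" for i
  proof -
    interpret P: Vector_Spaces.linear scale scale "top_product scale T d \<theta> i"
      by (rule linear_top_product[OF T])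
    show ?thesis unfolding P.sum using v by (intro sum.cong top_product_eigenvector T) auto
  qed
  then have "scale c (\<Sum>i=0..d. scale (b i) (top_product scale T d \<theta> i (\<Sum>j=0..d. v j)))
      = (\<Sum>i=0..d. \<Sum>j=0..d. scale (c * (b i * (\<Prod>k<i. \<theta> j - \<theta> (d - k)))) (v j))"
    by (simp add: scale_sum_right)
  also have "\<dots> = (\<Sum>j=0..d. scale (c * (\<Sum>i=0..d. b i * (\<Prod>k<i. \<theta> j - \<theta> (d - k)))) (v j))"
    by (subst sum.swap) (simp add: scale_sum_left sum_distrib_left)
  finally show ?thesis using s by simp
qed

lemma H_map_eigenvector_sum:
  assumes "Vector_Spaces.linear scale scale T" and "inj_on \<theta> {0..d}"
    and "\<And>j. j \<le> d \<Longrightarrow> v j \<in> eigenspace scale T (\<theta> j)"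
  shows "H_map q scale T d \<theta> (\<Sum>j=0..d. v j) = (\<Sum>j=0..d. scale (t_coeff q \<theta> j) (v j))"
  unfolding H_map_def using eigenprojection_sum[OF assms] by (intro sum.cong) auto

end

section \<open>The module of the \<open>q\<close>-Onsager algebra\<close>

lemma onsager_module_linear:
  assumes "onsager_module q scale \<rho>"
  shows "Vector_Spaces.linear scale scale (\<rho> (onsager_class q x))"
proof -
  have "onsager_class q x \<in> carrier (q_onsager q)"
    by (auto simp: q_onsager_def FactRing_def A_RCOSETS_def' onsager_class_def free_ring_def)
  then show ?thesis
    using assms by (auto simp: onsager_module_def end_ring_def ring_hom_def)
qed

theorem proposition3p21:
  fixes q a :: "'f::field"
    and scale :: "'f \<Rightarrow> 'v::ab_group_add \<Rightarrow> 'v"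
    and \<rho> :: "'f free_alg set \<Rightarrow> 'v \<Rightarrow> 'v"
    and A Astar H :: "'v \<Rightarrow> 'v"
    and d :: nat
    and \<theta> t :: "nat \<Rightarrow> 'f"
  assumes q_nonzero: "q \<noteq> 0"
    and q_not_root_of_unity: "\<And>n::nat. n \<ge> 1 \<Longrightarrow> q ^ n \<noteq> 1"
    and V_module: "onsager_module q scale \<rho>"
    and V_finite_dim: "\<exists>B. finite_dimensional_vector_space scale B"
    and V_dim: "vector_space.dim scale (UNIV :: 'v set) \<ge> 2"
    and V_irreducible: "onsager_irreducible q scale \<rho>"
    and A_eq: "A = \<rho> (onsager_class q (gen Gen_A))"
    and Astar_eq: "Astar = \<rho> (onsager_class q (gen Gen_Astar))"
    and A_diagonalizable: "diagonalizable scale A"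
    and Astar_diagonalizable: "diagonalizable scale Astar"
    and d_pos: "d \<ge> 1"
    and theta_distinct: "inj_on \<theta> {0..d}"
    and theta_eigenvalues: "eigenvalues scale A = \<theta> ` {0..d}"
    and a_nonzero: "a \<noteq> 0"
    and theta_form: "\<And>i. i \<le> d \<Longrightarrow>
          \<theta> i = a * q powi (int d - 2 * int i) + inverse a * q powi (2 * int i - int d)"
    and t_eq: "t = t_coeff q \<theta>"
    and H_eq: "H = H_map q scale A d \<theta>"
  shows "(H = (\<lambda>v. scale (t d) (\<Sum>i=0..d.
               scale (a powi (- int i) * q powi (int i * int d) / q_shifted_factorial (q\<^sup>2) (q\<^sup>2) i)
                 (top_product scale A d \<theta> i v))))
    \<and> bij H
    \<and> (inv_into UNIV H = (\<lambda>v. scale (inverse (t d)) (\<Sum>i=0..d.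
               scale (a powi (int i) * q powi (- (int i * int d)) /
                      q_shifted_factorial ((inverse q)\<^sup>2) ((inverse q)\<^sup>2) i)
                 (top_product scale A d \<theta> i v))))"
proof -
  let ?V = "\<lambda>j. eigenspace scale A (\<theta> j)"
  let ?P = "\<lambda>v. scale (t d) (\<Sum>i=0..d.
      scale (a powi (- int i) * q powi (int i * int d) / q_shifted_factorial (q\<^sup>2) (q\<^sup>2) i)
        (top_product scale A d \<theta> i v))"
  let ?Q = "\<lambda>v. scale (inverse (t d)) (\<Sum>i=0..d.
      scale (a powi (int i) * q powi (- (int i * int d)) /
          q_shifted_factorial ((inverse q)\<^sup>2) ((inverse q)\<^sup>2) i)
        (top_product scale A d \<theta> i v))"
  interpret vector_space scale using V_module by (simp add: onsager_module_def)
  have A: "Vector_Spaces.linear scale scale A"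
    unfolding A_eq by (rule onsager_module_linear[OF V_module])
  have t: "t i = a ^ (2 * i) * q ^ (2 * i * (d - i))" if "i \<le> d" for i
    unfolding t_eq using t_coeff_closed_form[OF q_nonzero q_not_root_of_unity a_nonzero theta_form that] .
  have t_nonzero: "t i \<noteq> 0" if "i \<le> d" for i
    using t[OF that] a_nonzero q_nonzero by simp
  have P_value: "t d * (\<Sum>i=0..d. a powi (- int i) * q powi (int i * int d)
      / q_shifted_factorial (q\<^sup>2) (q\<^sup>2) i * (\<Prod>k<i. \<theta> j - \<theta> (d - k))) = t j" if "j \<le> d" for j
    using newton_expansion_at_theta[OF q_nonzero q_not_root_of_unity a_nonzero theta_form that]
    by (simp add: t that)
  have inv_pow: "inverse q ^ n \<noteq> 1" if "n \<ge> 1" for n :: nat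
    using q_not_root_of_unity[OF that] by (simp add: power_inverse)
  have flip: "inverse x powi m = x powi (- m)" for x :: 'f and m
    by (simp add: power_int_inverse power_int_minus)
  \<comment> \<open>Inverting both parameters swaps the two summands of each eigenvalue.\<close>
  have theta_inverse: "\<theta> i = inverse a * inverse q powi (int d - 2 * int i)
      + inverse (inverse a) * inverse q powi (2 * int i - int d)" if "i \<le> d" for i
    using theta_form[OF that]
    unfolding flip inverse_inverse_eq by (simp add: add.commute)
  have Q_value: "inverse (t d) * (\<Sum>i=0..d. a powi (int i) * q powi (- (int i * int d))
      / q_shifted_factorial ((inverse q)\<^sup>2) ((inverse q)\<^sup>2) i * (\<Prod>k<i. \<theta> j - \<theta> (d - k)))
      = inverse (t j)" if "j \<le> d" for j
  proof -
    have "inverse q \<noteq> 0" and "inverse a \<noteq> 0" using q_nonzero a_nonzero by auto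
    from newton_expansion_at_theta[OF this(1) inv_pow this(2) theta_inverse that]
    show ?thesis unfolding flip minus_minus by (simp add: t that power_inverse)
  qed
  have H_sum: "H (\<Sum>j=0..d. v j) = (\<Sum>j=0..d. scale (t j) (v j))"
    if "\<And>j. j \<le> d \<Longrightarrow> v j \<in> ?V j" for v
    unfolding H_eq t_eq by (rule H_map_eigenvector_sum[OF A theta_distinct that])
  have P_sum: "?P (\<Sum>j=0..d. v j) = (\<Sum>j=0..d. scale (t j) (v j))"
    if "\<And>j. j \<le> d \<Longrightarrow> v j \<in> ?V j" for v
    by (rule newton_polynomial_eigenvector_sum[OF A that P_value])
  have Q_sum: "?Q (\<Sum>j=0..d. v j) = (\<Sum>j=0..d. scale (inverse (t j)) (v j))"
    if "\<And>j. j \<le> d \<Longrightarrow> v j \<in> ?V j" for v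
    by (rule newton_polynomial_eigenvector_sum[OF A that Q_value])
  have scaled: "scale (c j) (v j) \<in> ?V j" if "v j \<in> ?V j" for c :: "nat \<Rightarrow> 'f" and v j
    by (rule subspace_scale[OF eigenspace_subspace[OF A] that])
  have H_P: "H x = ?P x" and H_Q: "H (?Q x) = x" and Q_H: "?Q (H x) = x" for x
  proof -
    obtain v where "\<forall>j\<in>{0..d}. v j \<in> ?V j" and x: "x = (\<Sum>j=0..d. v j)"
      using diagonalizable_eigenvector_decomposition[OF A A_diagonalizable theta_eigenvalues, of x]
      by (elim exE conjE)
    then have v: "v j \<in> ?V j" if "j \<le> d" for j using that by simp
    show "H x = ?P x" unfolding x by (rule trans[OF H_sum[OF v] P_sum[OF v, symmetric]])
    have "H (?Q x) = (\<Sum>j=0..d. scale (t j) (scale (inverse (t j)) (v j)))"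
      unfolding x by (rule trans[OF arg_cong[of _ _ H, OF Q_sum[OF v]] H_sum]) (auto intro: scaled v)
    also have "\<dots> = x" unfolding x by (intro sum.cong) (auto simp: t_nonzero)
    finally show "H (?Q x) = x" .
    have "?Q (H x) = (\<Sum>j=0..d. scale (inverse (t j)) (scale (t j) (v j)))"
      unfolding x by (rule trans[OF arg_cong[of _ _ ?Q, OF H_sum[OF v]] Q_sum]) (auto intro: scaled v)
    also have "\<dots> = x" unfolding x by (intro sum.cong) (auto simp: t_nonzero)
    finally show "?Q (H x) = x" .
  qed
  have "H = ?P" using H_P by (rule ext)
  moreover have "bij H"
    by (rule o_bij[of ?Q]; rule ext) (simp_all only: o_apply id_apply Q_H H_Q)
  moreover have "inv_into UNIV H = ?Q"
    by (rule inv_equality[OF Q_H H_Q])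
  ultimately show ?thesis by (intro conjI)
qed

end
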